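(* For every integer $n\ge 2$, the cyclic Haar graph $H(3n,\{0,1,n\})$ is unsplittable. Equivalently, the cyclic configurations defined by these graphs are unsplittable.
   Context: For a positive integer $m$ and $S\subseteq\mathbb{Z}_m$, the cyclic Haar graph $H(m,S)$ has vertex set $\{i^+: i\in\mathbb{Z}_m\}\cup\{i^-: i\in\mathbb{Z}_m\}$. Its edges join $i^+$ to $(i+k)^-$ for each $i\in\mathbb{Z}_m$ and each $k\in S$. The square $G^2$ of a graph $G$ joins two distinct vertices iff their distance in $G$ is at most 2. A connected graph $G$ is splittable if there is a set $\Sigma\subseteq V(G)$ that is independent in $G^2$ and such that $G-\Sigma$ is disconnected. It is unsplittable otherwise. A configuration is splittable or unsplittable according to its Levi graph (point–line incidence graph). *)

theory Defs
  imports "Graph_Theory.Graph_Theory"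
begin

text \<open>
  A simple graph is represented by a \<^typ>\<open>'a pair_pre_digraph\<close> with a symmetric, irreflexive
  arc relation; every edge contributes both of its orientations.
\<close>

text \<open>The residues modulo \<open>m\<close> are represented by \<open>{0..<m}\<close>; \<open>Plus i\<close> and \<open>Minus i\<close> stand for
  \<open>i\<close> with superscript plus and minus.\<close>

datatype haar_vertex = Plus int | Minus int

definition cyclic_haar_graph :: "int \<Rightarrow> int set \<Rightarrow> haar_vertex pair_pre_digraph" where
  "cyclic_haar_graph m S =
     \<lparr> pverts = Plus ` {0..<m} \<union> Minus ` {0..<m},
       parcs = (\<Union>i\<in>{0..<m}. \<Union>k\<in>S.
         {(Plus i, Minus ((i + k) mod m)), (Minus ((i + k) mod m), Plus i)}) \<rparr>"

text \<open>With unit weights, \<open>wf_digraph.\<mu>\<close> is the usual graph distance (infinite between different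
  components).\<close>

definition graph_dist :: "'a pair_pre_digraph \<Rightarrow> 'a \<Rightarrow> 'a \<Rightarrow> ereal" where
  "graph_dist G u v = wf_digraph.\<mu> (with_proj G) (\<lambda>_. 1) u v"

definition graph_square :: "'a pair_pre_digraph \<Rightarrow> 'a pair_pre_digraph" where
  "graph_square G =
     \<lparr> pverts = pverts G,
       parcs = {(u, v). u \<in> pverts G \<and> v \<in> pverts G \<and> u \<noteq> v \<and> graph_dist G u v \<le> 2} \<rparr>"

definition independent_in :: "'a pair_pre_digraph \<Rightarrow> 'a set \<Rightarrow> bool" where
  "independent_in G A \<longleftrightarrow> A \<subseteq> pverts G \<and> (\<forall>u\<in>A. \<forall>v\<in>A. (u, v) \<notin> parcs G)"

text \<open>The library's \<open>connected\<close> is false for the graph without vertices, which is not meant to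
  count as disconnected either.\<close>

definition disconnected :: "('a, 'b) pre_digraph \<Rightarrow> bool" where
  "disconnected G \<longleftrightarrow> verts G \<noteq> {} \<and> \<not> connected G"

definition splittable :: "'a pair_pre_digraph \<Rightarrow> bool" where
  "splittable G \<longleftrightarrow> connected (with_proj G) \<and>
     (\<exists>\<Sigma>. independent_in (graph_square G) \<Sigma> \<and>
          disconnected (with_proj G \<restriction> (pverts G - \<Sigma>)))"

text \<open>Both notions are reserved for connected graphs, so this is not just the negation of
  \<open>splittable\<close>.\<close>

definition unsplittable :: "'a pair_pre_digraph \<Rightarrow> bool" where
  "unsplittable G \<longleftrightarrow> connected (with_proj G) \<and> \<not> splittable G"

text \<open>Lines are abstract objects rather than sets of points; only incidences between members of
  \<open>points\<close> and \<open>lines\<close> matter.\<close>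

record ('p, 'l) incidence_structure =
  points :: "'p set"
  lines :: "'l set"
  incident :: "'p \<Rightarrow> 'l \<Rightarrow> bool"

definition levi_graph :: "('p, 'l) incidence_structure \<Rightarrow> ('p + 'l) pair_pre_digraph" where
  "levi_graph C =
     \<lparr> pverts = Inl ` points C \<union> Inr ` lines C,
       parcs = (\<Union>p\<in>points C. \<Union>l\<in>{l \<in> lines C. incident C p l}.
         {(Inl p, Inr l), (Inr l, Inl p)}) \<rparr>"

definition unsplittable_configuration :: "('p, 'l) incidence_structure \<Rightarrow> bool" where
  "unsplittable_configuration C \<longleftrightarrow> unsplittable (levi_graph C)"

text \<open>
  A structure is defined by the bipartite graph \<open>H\<close> if \<open>H\<close> is, up to isomorphism, its Levi graph;
  either colour class of \<open>H\<close> may play the role of the points. For \<open>H = cyclic_haar_graph (3 * n) {0, 1, n}\<close>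
  every such structure has \<open>3 * n\<close> points and lines, three points on each line, three lines through
  each point, and the translations of the residues as automorphisms. For \<open>n \<ge> 3\<close> two points lie on
  at most one common line; for \<open>n = 2\<close> the graph contains 4-cycles and this fails, which is why no
  such condition is built in here.
\<close>

definition defined_by_graph ::
    "('p, 'l) incidence_structure \<Rightarrow> 'a pair_pre_digraph \<Rightarrow> bool" where
  "defined_by_graph C H \<longleftrightarrow> digraph_iso (with_proj (levi_graph C)) (with_proj H)"

end

theory Submission
  imports Defs
begin

text \<open>
  Since \<open>3n = 0\<close> modulo \<open>3n\<close>, the edges of type \<open>0\<close> and \<open>n\<close> form disjoint hexagons
  \<open>i\<^sup>+, (i+n)\<^sup>-, (i+n)\<^sup>+, (i+2n)\<^sup>-, (i+2n)\<^sup>+, i\<^sup>-\<close>, and the edges of type \<open>1\<close> arrange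
  these hexagons in a ring, each joined to the next by a matching of size three. A set \<open>\<Sigma>\<close> that is
  independent in the square meets every closed neighbourhood in at most one vertex. Hence it removes
  at most two matching edges between consecutive hexagons, and it can disconnect a hexagon only by
  removing two antipodal vertices. In that case the next hexagon loses none of its three minus
  vertices, so it stays connected, and it joins the two remaining pieces.
\<close>

section \<open>Independence in the square, via walks of length at most two\<close>

lemma graph_dist_le_1:
  assumes "wf_digraph (with_proj G)" and "(u, v) \<in> parcs G"
  shows "graph_dist G u v \<le> 1"
proof -
  interpret wf_digraph "with_proj G" by fact
  have "v \<in> pverts G"
    using head_in_verts[of "(u, v)"] assms(2) by simp
  then have "awalk u [(u, v)] v"
    using assms(2) by (simp add: awalk_simps)
  from min_cost_le_walk_cost[OF this, of "\<lambda>_. 1"] show ?thesis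
    by (simp add: graph_dist_def one_ereal_def)
qed

lemma graph_dist_le_2:
  assumes "wf_digraph (with_proj G)" and "(u, w) \<in> parcs G" and "(w, v) \<in> parcs G"
  shows "graph_dist G u v \<le> 2"
proof -
  interpret wf_digraph "with_proj G" by fact
  have "v \<in> pverts G"
    using head_in_verts[of "(w, v)"] assms(3) by simp
  then have "awalk u [(u, w), (w, v)] v"
    using assms(2,3) by (simp add: awalk_simps)
  from min_cost_le_walk_cost[OF this, of "\<lambda>_. 1"] show ?thesis
    by (simp add: graph_dist_def)
qed

lemma independent_in_square_adjacent:
  assumes "wf_digraph (with_proj G)" and "independent_in (graph_square G) A"
    and "(u, v) \<in> parcs G" and "u \<noteq> v"
  shows "u \<notin> A \<or> v \<notin> A"
proof -
  have "graph_dist G u v \<le> 2"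
    using graph_dist_le_1[OF assms(1,3)] by (rule order_trans) simp
  then show ?thesis
    using assms(2,4) by (auto simp: independent_in_def graph_square_def)
qed

lemma independent_in_square_common_neighbour:
  assumes "wf_digraph (with_proj G)" and "independent_in (graph_square G) A"
    and "(u, w) \<in> parcs G" and "(w, v) \<in> parcs G" and "u \<noteq> v"
  shows "u \<notin> A \<or> v \<notin> A"
  using graph_dist_le_2[OF assms(1,3,4)] assms(2,5)
  by (auto simp: independent_in_def graph_square_def)

section \<open>Periodic indexing of the vertices\<close>

text \<open>
  Indexing the vertices by all integers, periodically modulo \<open>3 * n\<close>, avoids modular arithmetic,
  and leaving the vertex type open covers the Haar graph and the Levi graphs isomorphic to it alike.
\<close>

locale haar_indexing =
  fixes G :: "'a pair_pre_digraph" and n :: int and P M :: "int \<Rightarrow> 'a"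
  assumes wf: "wf_digraph (with_proj G)"
    and n_ge_2: "n \<ge> 2"
    and verts_eq: "pverts G = range P \<union> range M"
    and P_eq_iff: "P i = P j \<longleftrightarrow> 3 * n dvd i - j"
    and M_eq_iff: "M i = M j \<longleftrightarrow> 3 * n dvd i - j"
    and P_neq_M: "P i \<noteq> M j"
    and arc_PM: "k \<in> {0, 1, n} \<Longrightarrow> (P i, M (i + k)) \<in> parcs G"
    and arc_MP: "k \<in> {0, 1, n} \<Longrightarrow> (M (i + k), P i) \<in> parcs G"
begin

lemma P_period: "P (i + 3 * n) = P i" and M_period: "M (i + 3 * n) = M i"
  by (simp_all add: P_eq_iff M_eq_iff)

text \<open>Makes the three neighbours of a vertex distinct; the last non-divisibility is the one
  that would fail for \<open>n = 1\<close>.\<close>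

lemma not_dvd: "\<not> 3 * n dvd n" "\<not> 3 * n dvd 1" "\<not> 3 * n dvd n - 1"
  using n_ge_2 by (auto dest: zdvd_imp_le)

section \<open>Deleting a set that is independent in the square\<close>

context
  fixes A :: "'a set"
  assumes independent: "independent_in (graph_square G) A"
begin

lemma P_or_M:
  assumes "k \<in> {0, 1, n}"
  shows "P i \<notin> A \<or> M (i + k) \<notin> A"
  using independent_in_square_adjacent[OF wf independent arc_PM[OF assms] P_neq_M] .

lemma P_or_P: "P i \<notin> A \<or> P (i + n) \<notin> A"
proof (rule independent_in_square_common_neighbour[OF wf independent])
  show "(P i, M (i + n)) \<in> parcs G" "(M (i + n), P (i + n)) \<in> parcs G"
    using arc_PM[of n i] arc_MP[of 0 "i + n"] by simp_all
  show "P i \<noteq> P (i + n)"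
    using not_dvd by (simp add: P_eq_iff)
qed

lemma M_or_M:
  assumes "k \<in> {0, 1, n}" "l \<in> {0, 1, n}" "\<not> 3 * n dvd k - l"
  shows "M (i + k) \<notin> A \<or> M (i + l) \<notin> A"
  using independent_in_square_common_neighbour[OF wf independent arc_MP[OF assms(1)]
      arc_PM[OF assms(2)]] assms(3) by (simp add: M_eq_iff)

lemma M_or_M_n: "M i \<notin> A \<or> M (i + n) \<notin> A"
  using M_or_M[of n 0 i] not_dvd by auto

lemma M_or_M_1: "M i \<notin> A \<or> M (i + 1) \<notin> A"
  using M_or_M[of 1 0 i] not_dvd by auto

lemma M_or_M_n_1: "M (i + n) \<notin> A \<or> M (i + 1) \<notin> A"
  using M_or_M[of n 1 i] not_dvd by auto

text \<open>Demanding both orientations of an arc makes symmetry immediate; the closure is reflexive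
  even at deleted vertices.\<close>

definition linked :: "'a \<Rightarrow> 'a \<Rightarrow> bool" where
  "linked = (\<lambda>u v. u \<notin> A \<and> v \<notin> A \<and> (u, v) \<in> parcs G \<and> (v, u) \<in> parcs G)\<^sup>*\<^sup>*"

lemma linked_refl [simp]: "linked u u"
  by (simp add: linked_def)

lemma linked_sym: "linked u v \<Longrightarrow> linked v u"
  unfolding linked_def by (rule sympD[OF symp_rtranclp]) (auto intro: sympI)

lemma linked_trans [trans]: "linked u v \<Longrightarrow> linked v w \<Longrightarrow> linked u w"
  unfolding linked_def by (rule rtranclp_trans)

section \<open>Links inside one hexagon\<close>

lemma linked_arc:
  assumes "k \<in> {0, 1, n}" "P i \<notin> A" "M (i + k) \<notin> A"
  shows "linked (P i) (M (i + k))"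
  unfolding linked_def using assms arc_PM[OF assms(1)] arc_MP[OF assms(1)]
  by (intro r_into_rtranclp) simp

lemmas linked_arc_0 = linked_arc[of 0, simplified]
  and linked_arc_1 = linked_arc[of 1, simplified]
  and linked_arc_n = linked_arc[of n, simplified]

text \<open>The short arc of the hexagon runs through \<open>M (i + n)\<close>. If that vertex is
  deleted, the long arc can be blocked only at its antipode \<open>P (i + 2 * n)\<close>, and then
  the next hexagon provides a detour.\<close>

lemma linked_P_P_n:
  assumes "P i \<notin> A" "P (i + n) \<notin> A"
  shows "linked (P i) (P (i + n))"
proof (cases "M (i + n) \<in> A")
  case False
  then show ?thesis
    using assms linked_arc_n linked_arc_0 linked_sym linked_trans by blast
next
  case M_n: True
  \<comment> \<open>These share the plus neighbours \<open>P i\<close> and \<open>P (i + n)\<close>,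
    respectively, with the deleted \<open>M (i + n)\<close>.\<close>
  have M_0: "M i \<notin> A" and M_2n: "M (i + 2 * n) \<notin> A"
    using M_or_M_n[of i] M_or_M_n[of "i + n"] M_n by (auto simp: algebra_simps)
  show ?thesis
  proof (cases "P (i + 2 * n) \<in> A")
    case False
    have "linked (P i) (M i)"
      using assms M_0 by (intro linked_arc_0)
    also have "linked (M i) (P (i + 2 * n))"
      using linked_arc_n[of "i + 2 * n"] M_period[of i] False M_0
      by (auto intro: linked_sym simp: algebra_simps)
    also have "linked (P (i + 2 * n)) (M (i + 2 * n))"
      using False M_2n by (intro linked_arc_0)
    also have "linked (M (i + 2 * n)) (P (i + n))"
      using linked_arc_n[of "i + n"] assms M_2n
      by (auto intro: linked_sym simp: algebra_simps)
    finally show ?thesis .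
  next
    case P_2n: True
    \<comment> \<open>the hexagon of \<open>i\<close> is disconnected, so the path has to run through the hexagon of \<open>i + 1\<close>\<close>
    have M_1: "M (i + 1) \<notin> A"
      using M_or_M_n_1[of i] M_n by auto
    have M_n1: "M (i + 1 + n) \<notin> A"
      using M_or_M_1[of "i + n"] M_n by (auto simp: algebra_simps)
    \<comment> \<open>Unlike the other two, this vertex is saved by being adjacent to the deleted
      \<open>P (i + 2 * n)\<close>.\<close>
    have M_2n1: "M (i + 1 + 2 * n) \<notin> A"
      using P_or_M[of 1 "i + 2 * n"] P_2n by (auto simp: algebra_simps)
    \<comment> \<open>Again there is a short arc, through \<open>P (i + 1)\<close>, and otherwise a
      long one, whose minus vertices all survive.\<close>
    have "linked (M (i + 1)) (M (i + 1 + n))"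
    proof (cases "P (i + 1) \<in> A")
      case False
      then show ?thesis
        using linked_arc_0[of "i + 1"] linked_arc_n[of "i + 1"] M_1 M_n1 linked_sym linked_trans
        by blast
    next
      case True
      have P_n1: "P (i + 1 + n) \<notin> A" and P_2n1: "P (i + 1 + 2 * n) \<notin> A"
        using P_or_P[of "i + 1"] P_or_P[of "i + 1 + 2 * n"] P_period[of "i + 1"] True
        by (auto simp: algebra_simps)
      \<comment> \<open>The edge of type \<open>n\<close> from \<open>P (i + 1 + 2 * n)\<close> ends
        at \<open>M (i + 1 + 3 * n)\<close>, which is \<open>M (i + 1)\<close>.\<close>
      have "linked (M (i + 1)) (P (i + 1 + 2 * n))"
        using linked_arc_n[of "i + 1 + 2 * n"] M_period[of "i + 1"] P_2n1 M_1
        by (auto intro: linked_sym simp: algebra_simps)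
      also have "linked (P (i + 1 + 2 * n)) (M (i + 1 + 2 * n))"
        using P_2n1 M_2n1 by (intro linked_arc_0)
      also have "linked (M (i + 1 + 2 * n)) (P (i + 1 + n))"
        using linked_arc_n[of "i + 1 + n"] P_n1 M_2n1
        by (auto intro: linked_sym simp: algebra_simps)
      also have "linked (P (i + 1 + n)) (M (i + 1 + n))"
        using P_n1 M_n1 by (intro linked_arc_0)
      finally show ?thesis .
    qed
    moreover have "linked (P i) (M (i + 1))"
      using assms M_1 by (intro linked_arc_1)
    moreover have "linked (P (i + n)) (M (i + 1 + n))"
      using linked_arc_1[of "i + n"] assms M_n1 by (auto simp: algebra_simps)
    ultimately show ?thesis
      using linked_sym linked_trans by blast
  qed
qed

section \<open>Passing from hexagon to hexagon around the ring\<close>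

definition plus_triple :: "int \<Rightarrow> 'a set" where
  "plus_triple i = {P i, P (i + n), P (i + 2 * n)} - A"

lemma plus_triple_linked:
  assumes "u \<in> plus_triple i" "v \<in> plus_triple i"
  shows "linked u v"
proof -
  have "linked (P (i + n)) (P (i + 2 * n))" if "P (i + n) \<notin> A" "P (i + 2 * n) \<notin> A"
    using linked_P_P_n[of "i + n"] that by (simp add: algebra_simps)
  moreover have "linked (P (i + 2 * n)) (P i)" if "P (i + 2 * n) \<notin> A" "P i \<notin> A"
    using linked_P_P_n[of "i + 2 * n"] P_period[of i] that by (simp add: algebra_simps)
  ultimately show ?thesis
    using assms linked_P_P_n[of i] by (auto simp: plus_triple_def intro: linked_sym)
qed

text \<open>The triple belongs to a hexagon, so its base point may be moved to whichever matching
  edge survives.\<close>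

lemma plus_triple_shift: "plus_triple (i + n) = plus_triple i"
  using P_period[of i] by (auto simp: plus_triple_def algebra_simps)

lemma plus_triple_nonempty: "plus_triple i \<noteq> {}"
  using P_or_P[of i] by (auto simp: plus_triple_def)

text \<open>In its hexagon \<open>M i\<close> is adjacent to \<open>P i\<close> and
  \<open>P (i + 2 * n)\<close>, which are not both deleted since they have a common
  neighbour.\<close>

lemma M_linked_plus_triple:
  assumes "M i \<notin> A"
  shows "\<exists>u \<in> plus_triple i. linked (M i) u"
proof (cases "P i \<in> A")
  case False
  then show ?thesis
    using assms linked_arc_0[of i] linked_sym by (auto simp: plus_triple_def)
next
  case True
  then have "P (i + 2 * n) \<notin> A"
    using P_or_P[of "i + 2 * n"] P_period[of i] by (auto simp: algebra_simps)
  then show ?thesis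
    using assms linked_arc_n[of "i + 2 * n"] M_period[of i] linked_sym
    by (auto simp: plus_triple_def algebra_simps)
qed

text \<open>Of the three matching edges to the next hexagon, at most one loses its plus end and at
  most one its minus end; \<open>j\<close> is the base point of an intact one.\<close>

lemma matching_edge_survives:
  "\<exists>j. plus_triple j = plus_triple i \<and> plus_triple (j + 1) = plus_triple (i + 1) \<and>
    P j \<notin> A \<and> M (j + 1) \<notin> A"
proof -
  have "P i \<notin> A \<and> M (i + 1) \<notin> A \<or> P (i + n) \<notin> A \<and> M (i + n + 1) \<notin> A \<or>
      P (i + n + n) \<notin> A \<and> M (i + n + n + 1) \<notin> A"
    using P_or_P[of i] P_or_P[of "i + n"] P_or_P[of "i + n + n"] P_period[of i]
      M_or_M_n[of "i + 1"] M_or_M_n[of "i + 1 + n"] M_or_M_n[of "i + 1 + n + n"]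
      M_period[of "i + 1"]
    by (auto simp: algebra_simps)
  moreover have "plus_triple (i + n + 1) = plus_triple (i + 1)"
    "plus_triple (i + n + n + 1) = plus_triple (i + 1)"
    using plus_triple_shift[of "i + 1"] plus_triple_shift[of "i + 1 + n"]
    by (simp_all add: algebra_simps)
  ultimately show ?thesis
    by (metis plus_triple_shift)
qed

lemma plus_triple_step:
  assumes "u \<in> plus_triple i" "v \<in> plus_triple (i + 1)"
  shows "linked u v"
proof -
  obtain j where j: "plus_triple j = plus_triple i" "plus_triple (j + 1) = plus_triple (i + 1)"
      "P j \<notin> A" "M (j + 1) \<notin> A"
    using matching_edge_survives by blast
  obtain w where w: "w \<in> plus_triple (i + 1)" "linked (M (j + 1)) w"
    using M_linked_plus_triple[OF j(4)] j(2) by auto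
  have "P j \<in> plus_triple i"
    unfolding j(1)[symmetric] using j(3) by (simp add: plus_triple_def)
  then have "linked u (P j)"
    using assms(1) plus_triple_linked by blast
  also have "linked (P j) (M (j + 1))"
    using j by (intro linked_arc_1)
  also note w(2)
  also have "linked w v"
    using assms(2) w(1) plus_triple_linked by blast
  finally show ?thesis .
qed

text \<open>Single steps are chained; nonemptiness of the triples supplies the intermediate
  vertices.\<close>

lemma plus_triple_steps:
  assumes "u \<in> plus_triple i" "v \<in> plus_triple (i + int k)"
  shows "linked u v"
  using assms(2)
proof (induction k arbitrary: v)
  case 0
  then show ?case
    using assms(1) plus_triple_linked by simp
next
  case (Suc k)
  obtain w where w: "w \<in> plus_triple (i + int k)"
    using plus_triple_nonempty by blast
  have "linked w v"
    using plus_triple_step[OF w] Suc.prems by (simp add: algebra_simps)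
  with Suc.IH[OF w] show ?case
    by (rule linked_trans)
qed

lemma P_linked_P:
  assumes "P i \<notin> A" "P j \<notin> A"
  shows "linked (P i) (P j)"
proof -
  \<comment> \<open>Integer indices are linearly ordered, so a walk upwards from the smaller one
    joins the two.\<close>
  have *: "linked (P i) (P j)" if "i \<le> j" "P i \<notin> A" "P j \<notin> A" for i j
    using that plus_triple_steps[of "P i" i "P j" "nat (j - i)"] by (simp add: plus_triple_def)
  show ?thesis
    using *[of i j] *[of j i] assms by (cases "i \<le> j") (auto intro: linked_sym)
qed

text \<open>Each surviving minus vertex is linked to a surviving plus vertex, which reduces the
  claim to plus vertices.\<close>

lemma all_linked:
  assumes "u \<in> pverts G - A" "v \<in> pverts G - A"
  shows "linked u v"
proof -
  have "\<exists>i. P i \<notin> A \<and> linked w (P i)" if "w \<in> pverts G - A" for w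
    using that M_linked_plus_triple by (fastforce simp: verts_eq plus_triple_def)
  then show ?thesis
    using assms P_linked_P linked_sym linked_trans by meson
qed

section \<open>From links to connectedness and unsplittability\<close>

lemma connected_delete: "connected (with_proj G \<restriction> (pverts G - A))"
proof -
  let ?H = "with_proj G \<restriction> (pverts G - A)"
  interpret G: wf_digraph "with_proj G" by (rule wf)
  interpret H: wf_digraph ?H
    by (rule G.wellformed_induce_subgraph)
  have "u \<rightarrow>\<^sup>*\<^bsub>?H\<^esub> v" if "u \<in> verts ?H" "v \<in> verts ?H" for u v
  proof -
    have "linked u v"
      using that all_linked by simp
    then show ?thesis
      unfolding linked_def
    proof induction
      case base
      show ?case
        using that by simp
    next
      case (step y z)
      then have "(y, z) \<in> arcs ?H"
        using G.wellformed[of "(y, z)"] by simp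
      then have "y \<rightarrow>\<^bsub>?H\<^esub> z"
        by (force simp: arcs_ends_conv)
      with step.IH show ?case
        by (rule H.reachable_adj_trans)
    qed
  qed
  \<comment> \<open>The library's \<open>connected\<close> excludes the graph without
    vertices.\<close>
  moreover have "verts ?H \<noteq> {}"
    using plus_triple_nonempty[of 0] by (auto simp: plus_triple_def verts_eq)
  ultimately show ?thesis
    by (intro H.connectedI H.reachable_mk_symmetricI)
qed

end

lemma unsplittable: "unsplittable G"
proof -
  interpret G: wf_digraph "with_proj G" by (rule wf)
  have "with_proj G \<restriction> pverts G = with_proj G"
    using G.wellformed by (auto simp: induce_subgraph_def with_proj_def)
  \<comment> \<open>Deleting the empty set yields connectedness of \<open>G\<close> itself.\<close>
  moreover have "independent_in (graph_square G) {}"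
    by (simp add: independent_in_def)
  ultimately have "connected (with_proj G)"
    using connected_delete by force
  then show ?thesis
    using connected_delete by (auto simp: unsplittable_def splittable_def disconnected_def)
qed

end

section \<open>Indexing the Haar graph and its isomorphic copies\<close>

lemma haar_indexing_cyclic_haar_graph:
  fixes n :: int
  assumes "n \<ge> 2"
  shows "haar_indexing (cyclic_haar_graph (3 * n) {0, 1, n}) n
    (\<lambda>i. Plus (i mod (3 * n))) (\<lambda>i. Minus (i mod (3 * n)))"
proof
  let ?G = "cyclic_haar_graph (3 * n) {0, 1, n}"
  have range: "range (\<lambda>i. i mod (3 * n)) = {0..<3 * n}"
    using assms by (auto simp: image_iff) (metis mod_pos_pos_trivial)
  show "pverts ?G = range (\<lambda>i. Plus (i mod (3 * n))) \<union> range (\<lambda>i. Minus (i mod (3 * n)))"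
    unfolding cyclic_haar_graph_def range[symmetric] by auto
  show "e \<in> arcs (with_proj ?G) \<Longrightarrow> tail (with_proj ?G) e \<in> verts (with_proj ?G)"
    "e \<in> arcs (with_proj ?G) \<Longrightarrow> head (with_proj ?G) e \<in> verts (with_proj ?G)" for e
    using assms by (auto simp: cyclic_haar_graph_def)
  have "(Plus (i mod (3 * n)), Minus ((i + k) mod (3 * n))) \<in> parcs ?G \<and>
      (Minus ((i + k) mod (3 * n)), Plus (i mod (3 * n))) \<in> parcs ?G"
    if "k \<in> {0, 1, n}" for i k
  proof -
    have "i mod (3 * n) \<in> {0..<3 * n}" "(i + k) mod (3 * n) = (i mod (3 * n) + k) mod (3 * n)"
      using assms by (simp_all add: mod_add_left_eq)
    then show ?thesis
      using that unfolding cyclic_haar_graph_def by auto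
  qed
  then show "k \<in> {0, 1, n} \<Longrightarrow>
      (Plus (i mod (3 * n)), Minus ((i + k) mod (3 * n))) \<in> parcs ?G"
    "k \<in> {0, 1, n} \<Longrightarrow>
      (Minus ((i + k) mod (3 * n)), Plus (i mod (3 * n))) \<in> parcs ?G" for i k
    by blast+
qed (use assms in \<open>auto simp: mod_eq_dvd_iff\<close>)

text \<open>The isomorphism leads from \<open>G\<close> to \<open>H\<close>, so the indexing is
  carried back along its inverse on vertices.\<close>

lemma haar_indexing_iso:
  assumes "haar_indexing H n P M" and "digraph_iso (with_proj G) (with_proj H)"
  shows "\<exists>P' M'. haar_indexing G n P' M'"
proof -
  interpret H: haar_indexing H n P M by fact
  obtain f where f: "pre_digraph.digraph_isomorphism (with_proj G) f"
    and H: "with_proj H = app_iso f (with_proj G)"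
    using assms(2) by (auto simp: digraph_iso_def)
  have wf: "wf_digraph (with_proj G)" and inj: "inj_on (iso_verts f) (pverts G)"
    and ends: "\<And>a. a \<in> parcs G \<Longrightarrow> iso_verts f (fst a) = iso_tail f (iso_arcs f a) \<and>
      iso_verts f (snd a) = iso_head f (iso_arcs f a)"
    using f by (simp_all add: pre_digraph.digraph_isomorphism_def)
  interpret G: wf_digraph "with_proj G" by (rule wf)
  have verts_H: "pverts H = iso_verts f ` pverts G"
    using arg_cong[OF H, of verts] by simp
  have arcs_H: "parcs H = iso_arcs f ` parcs G"
    using arg_cong[OF H, of arcs] by simp
  \<comment> \<open>\<open>app_iso\<close> takes its tail and head maps from \<open>f\<close>;
    equality with a pair digraph forces them to be the projections.\<close>
  have tail: "iso_tail f = fst" and head: "iso_head f = snd"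
    using arg_cong[OF H, of tail] arg_cong[OF H, of head] by simp_all
  define g where "g = the_inv_into (pverts G) (iso_verts f)"
  have inj_g: "inj_on g (pverts H)"
    unfolding g_def verts_H by (rule inj_on_the_inv_into[OF inj])
  have image_g: "g ` pverts H = pverts G"
    unfolding g_def verts_H by (rule the_inv_into_onto[OF inj])
  have arc_g: "(g u, g v) \<in> parcs G" if uv: "(u, v) \<in> parcs H" for u v
  proof -
    obtain x y where xy: "(x, y) \<in> parcs G" "(u, v) = iso_arcs f (x, y)"
      using uv by (auto simp: arcs_H)
    then have "u = iso_verts f x" "v = iso_verts f y"
      using ends[OF xy(1)] by (simp_all add: tail head flip: xy(2))
    moreover have "x \<in> pverts G" "y \<in> pverts G"
      using G.wellformed[of "(x, y)"] xy(1) by simp_all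
    ultimately show ?thesis
      using xy(1) inj by (simp add: g_def the_inv_into_f_f)
  qed
  have verts: "P i \<in> pverts H" "M i \<in> pverts H" for i
    by (auto simp: H.verts_eq)
  note g_eq_iff = inj_on_eq_iff[OF inj_g]
  have "haar_indexing G n (g \<circ> P) (g \<circ> M)"
  proof (rule haar_indexing.intro[OF wf H.n_ge_2])
    show "pverts G = range (g \<circ> P) \<union> range (g \<circ> M)"
      using image_g by (simp add: H.verts_eq image_Un image_comp)
  \<comment> \<open>Without \<open>insert_iff\<close> the condition \<open>k \<in> {0, 1, n}\<close>
    stays intact and matches the premises of \<open>H.arc_PM\<close> and
    \<open>H.arc_MP\<close>.\<close>
  qed (simp_all add: g_eq_iff verts H.P_eq_iff H.M_eq_iff H.P_neq_M arc_g H.arc_PM H.arc_MP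
      del: insert_iff)
  then show ?thesis by blast
qed

theorem theorem10:
  fixes n :: int
  assumes "n \<ge> 2"
  shows "unsplittable (cyclic_haar_graph (3 * n) {0, 1, n}) \<and>
    (\<forall>C :: ('p, 'l) incidence_structure.
       defined_by_graph C (cyclic_haar_graph (3 * n) {0, 1, n}) \<longrightarrow>
       unsplittable_configuration C)"
proof (intro conjI allI impI)
  note indexing = haar_indexing_cyclic_haar_graph[OF assms]
  show "unsplittable (cyclic_haar_graph (3 * n) {0, 1, n})"
    by (rule haar_indexing.unsplittable[OF indexing])
  fix C :: "('p, 'l) incidence_structure"
  assume "defined_by_graph C (cyclic_haar_graph (3 * n) {0, 1, n})"
  then show "unsplittable_configuration C"
    using haar_indexing_iso[OF indexing] haar_indexing.unsplittable
    unfolding defined_by_graph_def unsplittable_configuration_def by metis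
qed

end
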